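(* Let $\mathcal{M}=\mathcal{M}(\Sigma,I)$ be a trace monoid, let $F:\mathcal{M}\to\mathbb{R}$ be any function, and let $H:\mathcal{M}\to\mathbb{R}$ be the graded Möbius transform of $F$. Then for every $u\in\mathcal{M}$, \[ F(u)=\sum_{x\in\mathcal{M}(u)}H(x), \] where $\mathcal{M}(u)=\{x\in\mathcal{M} : \tau(x)=\tau(u)\ \text{and}\ u\leq x\}$ if $u\neq 0$, and $\mathcal{M}(0)=\mathscr{C}$.
   Context: Let $\Sigma$ be a finite alphabet with $|\Sigma|>1$ and $I\subseteq\Sigma\times\Sigma$ a symmetric irreflexive relation. The trace monoid $\mathcal{M}=\mathcal{M}(\Sigma,I)$ is the quotient of the free monoid $\Sigma^*$ by the congruence generated by the pairs $(ab,ba)$ for $(a,b)\in I$; its elements are traces, its product is written $\cdot$ and its identity (the empty trace) is $0$. The prefix order on $\mathcal{M}$ is $u\leq v$ iff $v=u\cdot w$ for some $w\in\mathcal{M}$. A clique is a subset $c\subseteq\Sigma$ such that any two distinct letters of $c$ are related by $I$ (the empty set is the clique $0$); a clique $\{a_1,\dots,a_k\}$ is identified with the trace $a_1\cdot\ldots\cdot a_k$ (independent of the enumeration). $\mathscr{C}$ denotes the set of cliques, $|c|$ the cardinality of $c$, and for cliques $c'\geq c$ means $c\subseteq c'$. For cliques $c,c'$, write $c\to c'$ if for every $b\in c'$ there is $a\in c$ with $(a,b)\notin I$. Every nonempty trace $u$ has a unique decomposition $u=c_1\cdot\ldots\cdot c_n$ with $n\geq1$, nonempty cliques $c_i$, and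 $c_i\to c_{i+1}$ for $1\le i<n$ (the Cartier–Foata decomposition); $c_n$ is its last clique, and $\tau(u)=n$ is the height of $u$, with $\tau(0)=0$. The graded Möbius transform of $F:\mathcal{M}\to\mathbb{R}$ is $H:\mathcal{M}\to\mathbb{R}$ defined as follows: for $u\neq0$, let $c$ be the last clique of the Cartier–Foata decomposition of $u$ and $v$ the unique trace with $u=v\cdot c$; then $H(u)=\sum_{c'\in\mathscr{C},\,c'\geq c}(-1)^{|c'|-|c|}F(v\cdot c')$; and $H(0)=\sum_{c\in\mathscr{C}}(-1)^{|c|}F(c)$. *)

theory Defs
  imports Complex_Main "HOL-Algebra.Divisibility"
begin

text \<open>The least congruence on the free monoid \<open>lists \<Sigma>\<close> that contains all pairs \<open>(ab, ba)\<close> with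
  \<open>(a, b) \<in> I\<close>.\<close>

inductive_set trace_cong :: "'a set \<Rightarrow> 'a rel \<Rightarrow> 'a list rel" for \<Sigma> I where
  commute: "(a, b) \<in> I \<Longrightarrow> a \<in> \<Sigma> \<Longrightarrow> b \<in> \<Sigma> \<Longrightarrow> ([a, b], [b, a]) \<in> trace_cong \<Sigma> I"
| refl: "w \<in> lists \<Sigma> \<Longrightarrow> (w, w) \<in> trace_cong \<Sigma> I"
| sym: "(v, w) \<in> trace_cong \<Sigma> I \<Longrightarrow> (w, v) \<in> trace_cong \<Sigma> I"
| trans: "(u, v) \<in> trace_cong \<Sigma> I \<Longrightarrow> (v, w) \<in> trace_cong \<Sigma> I \<Longrightarrow> (u, w) \<in> trace_cong \<Sigma> I"
| append: "(v, v') \<in> trace_cong \<Sigma> I \<Longrightarrow> (w, w') \<in> trace_cong \<Sigma> I \<Longrightarrow> (v @ w, v' @ w') \<in> trace_cong \<Sigma> I"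

definition trace_of :: "'a set \<Rightarrow> 'a rel \<Rightarrow> 'a list \<Rightarrow> 'a list set" where
  "trace_of \<Sigma> I w = trace_cong \<Sigma> I `` {w}"

definition trace_monoid :: "'a set \<Rightarrow> 'a rel \<Rightarrow> 'a list set monoid" where
  "trace_monoid \<Sigma> I =
    \<lparr>carrier = lists \<Sigma> // trace_cong \<Sigma> I,
     mult = (\<lambda>u v. \<Union>x\<in>u. \<Union>y\<in>v. trace_of \<Sigma> I (x @ y)),
     one = trace_of \<Sigma> I []\<rparr>"

lemma trace_cong_in_lists:
  "(v, w) \<in> trace_cong \<Sigma> I \<Longrightarrow> v \<in> lists \<Sigma> \<and> w \<in> lists \<Sigma>"
  by (induction rule: trace_cong.induct) auto

lemma equiv_trace_cong: "equiv (lists \<Sigma>) (trace_cong \<Sigma> I)"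
proof (rule equivI)
  show "trace_cong \<Sigma> I \<subseteq> lists \<Sigma> \<times> lists \<Sigma>"
    using trace_cong_in_lists by fast
  show "refl_on (lists \<Sigma>) (trace_cong \<Sigma> I)"
    by (auto simp: refl_on_def intro: trace_cong.refl)
  show "Relation.sym (trace_cong \<Sigma> I)"
    by (auto intro: symI trace_cong.sym)
  show "Relation.trans (trace_cong \<Sigma> I)"
    by (auto intro: transI trace_cong.trans)
qed

lemma trace_of_eq_iff:
  assumes "v \<in> lists \<Sigma>" "w \<in> lists \<Sigma>"
  shows "trace_of \<Sigma> I v = trace_of \<Sigma> I w \<longleftrightarrow> (v, w) \<in> trace_cong \<Sigma> I"
  using eq_equiv_class_iff[OF equiv_trace_cong assms] by (simp add: trace_of_def)

lemma carrier_trace_monoid: "carrier (trace_monoid \<Sigma> I) = trace_of \<Sigma> I ` lists \<Sigma>"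
  by (auto simp: trace_monoid_def trace_of_def quotient_def)

lemma one_trace_monoid: "\<one>\<^bsub>trace_monoid \<Sigma> I\<^esub> = trace_of \<Sigma> I []"
  by (simp add: trace_monoid_def)

lemma mult_trace_monoid:
  assumes "v \<in> lists \<Sigma>" "w \<in> lists \<Sigma>"
  shows "trace_of \<Sigma> I v \<otimes>\<^bsub>trace_monoid \<Sigma> I\<^esub> trace_of \<Sigma> I w = trace_of \<Sigma> I (v @ w)"
proof -
  have "trace_of \<Sigma> I (x @ y) = trace_of \<Sigma> I (v @ w)"
    if "x \<in> trace_of \<Sigma> I v" "y \<in> trace_of \<Sigma> I w" for x y
  proof -
    have *: "(v, x) \<in> trace_cong \<Sigma> I" "(w, y) \<in> trace_cong \<Sigma> I"
      using that by (auto simp: trace_of_def)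
    then have "(x @ y, v @ w) \<in> trace_cong \<Sigma> I"
      by (blast intro: trace_cong.append trace_cong.sym)
    then show ?thesis
      using trace_cong_in_lists trace_of_eq_iff by metis
  qed
  then have "(\<Union>x\<in>trace_of \<Sigma> I v. \<Union>y\<in>trace_of \<Sigma> I w. trace_of \<Sigma> I (x @ y)) =
      (\<Union>x\<in>trace_of \<Sigma> I v. \<Union>y\<in>trace_of \<Sigma> I w. trace_of \<Sigma> I (v @ w))"
    by (intro SUP_cong HOL.refl)
  moreover have "v \<in> trace_of \<Sigma> I v" "w \<in> trace_of \<Sigma> I w"
    using assms by (auto simp: trace_of_def intro: trace_cong.refl)
  ultimately show ?thesis
    by (auto simp: trace_monoid_def)
qed

lemma monoid_trace_monoid: "monoid (trace_monoid \<Sigma> I)" (is "monoid ?M")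
proof (rule monoidI)
  fix x y z assume "x \<in> carrier ?M" "y \<in> carrier ?M" "z \<in> carrier ?M"
  then obtain u v w where
    "x = trace_of \<Sigma> I u" "y = trace_of \<Sigma> I v" "z = trace_of \<Sigma> I w"
    and "u \<in> lists \<Sigma>" "v \<in> lists \<Sigma>" "w \<in> lists \<Sigma>"
    unfolding carrier_trace_monoid by blast
  then show "x \<otimes>\<^bsub>?M\<^esub> y \<otimes>\<^bsub>?M\<^esub> z = x \<otimes>\<^bsub>?M\<^esub> (y \<otimes>\<^bsub>?M\<^esub> z)"
    by (simp only: mult_trace_monoid append_in_lists_conv append_assoc simp_thms)
next
  fix x y assume "x \<in> carrier ?M" "y \<in> carrier ?M"
  then obtain u v where
    "x = trace_of \<Sigma> I u" "y = trace_of \<Sigma> I v" and "u \<in> lists \<Sigma>" "v \<in> lists \<Sigma>"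
    unfolding carrier_trace_monoid by blast
  then show "x \<otimes>\<^bsub>?M\<^esub> y \<in> carrier ?M"
    by (simp only: carrier_trace_monoid mult_trace_monoid append_in_lists_conv imageI simp_thms)
next
  show "\<one>\<^bsub>?M\<^esub> \<in> carrier ?M"
    by (simp add: carrier_trace_monoid one_trace_monoid)
next
  fix x assume "x \<in> carrier ?M"
  then obtain u where "x = trace_of \<Sigma> I u" "u \<in> lists \<Sigma>"
    unfolding carrier_trace_monoid by blast
  then show "\<one>\<^bsub>?M\<^esub> \<otimes>\<^bsub>?M\<^esub> x = x" "x \<otimes>\<^bsub>?M\<^esub> \<one>\<^bsub>?M\<^esub> = x"
    by (simp_all only: one_trace_monoid mult_trace_monoid lists.Nil append.simps append_Nil2)
qed

definition cliques :: "'a set \<Rightarrow> 'a rel \<Rightarrow> 'a set set" where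
  "cliques \<Sigma> I = {c. c \<subseteq> \<Sigma> \<and> (\<forall>a\<in>c. \<forall>b\<in>c. a \<noteq> b \<longrightarrow> (a, b) \<in> I)}"

text \<open>The choice of the enumeration is irrelevant, see lemma \<open>clique_trace_eq\<close> below.\<close>

definition clique_trace :: "'a set \<Rightarrow> 'a rel \<Rightarrow> 'a set \<Rightarrow> 'a list set" where
  "clique_trace \<Sigma> I c = trace_of \<Sigma> I (SOME w. distinct w \<and> set w = c)"

lemma trace_cong_move_front:
  assumes "set ys \<subseteq> \<Sigma>" "x \<in> \<Sigma>" "\<forall>y\<in>set ys. (y, x) \<in> I"
  shows "(ys @ [x], x # ys) \<in> trace_cong \<Sigma> I"
  using assms
proof (induction ys)
  case Nil
  then show ?case by (auto intro: trace_cong.refl)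
next
  case (Cons y ys)
  then have "([y] @ (ys @ [x]), [y] @ (x # ys)) \<in> trace_cong \<Sigma> I"
    by (intro trace_cong.append trace_cong.refl) auto
  moreover from Cons.prems have "([y, x] @ ys, [x, y] @ ys) \<in> trace_cong \<Sigma> I"
    by (intro trace_cong.append trace_cong.refl trace_cong.commute) auto
  ultimately show ?case
    using trace_cong.trans by fastforce
qed

lemma trace_cong_enumerations:
  assumes "set v \<in> cliques \<Sigma> I" "distinct v" "distinct w" "set w = set v"
  shows "(v, w) \<in> trace_cong \<Sigma> I"
  using assms
proof (induction v arbitrary: w)
  case Nil
  then show ?case by (auto intro: trace_cong.refl)
next
  case (Cons x v)
  then obtain ys zs where w: "w = ys @ x # zs"
    by (metis list.set_intros(1) split_list)
  have sub: "set ys \<subseteq> \<Sigma>" "set zs \<subseteq> \<Sigma>" "x \<in> \<Sigma>" and I: "\<forall>y\<in>set ys. (y, x) \<in> I"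
    using Cons.prems w by (auto simp: cliques_def)
  have "set v = set (ys @ zs)"
    using Cons.prems w by auto
  then have "(v, ys @ zs) \<in> trace_cong \<Sigma> I"
    using Cons.prems w by (intro Cons.IH) (auto simp: cliques_def)
  then have "([x] @ v, [x] @ (ys @ zs)) \<in> trace_cong \<Sigma> I"
    using sub by (intro trace_cong.append trace_cong.refl) auto
  moreover have "((ys @ [x]) @ zs, (x # ys) @ zs) \<in> trace_cong \<Sigma> I"
    using sub I by (intro trace_cong.append trace_cong_move_front trace_cong.refl) auto
  ultimately show ?case
    using trace_cong.trans trace_cong.sym w by fastforce
qed

lemma clique_trace_eq:
  assumes "c \<in> cliques \<Sigma> I" "distinct w" "set w = c"
  shows "clique_trace \<Sigma> I c = trace_of \<Sigma> I w"
proof -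
  let ?v = "SOME w. distinct w \<and> set w = c"
  have v: "distinct ?v \<and> set ?v = c"
    by (rule someI[of _ w]) (use assms in simp)
  then have "(?v, w) \<in> trace_cong \<Sigma> I"
    using assms by (intro trace_cong_enumerations) auto
  then show ?thesis
    unfolding clique_trace_def using trace_cong_in_lists trace_of_eq_iff by metis
qed

definition clique_arrow :: "'a rel \<Rightarrow> 'a set \<Rightarrow> 'a set \<Rightarrow> bool" where
  "clique_arrow I c c' \<longleftrightarrow> (\<forall>b\<in>c'. \<exists>a\<in>c. (a, b) \<notin> I)"

definition is_cartier_foata :: "'a set \<Rightarrow> 'a rel \<Rightarrow> 'a list set \<Rightarrow> 'a set list \<Rightarrow> bool" where
  "is_cartier_foata \<Sigma> I u cs \<longleftrightarrow>
    cs \<noteq> [] \<and> set cs \<subseteq> cliques \<Sigma> I - {{}} \<and> successively (clique_arrow I) cs \<and>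
    u = foldr (mult (trace_monoid \<Sigma> I)) (map (clique_trace \<Sigma> I) cs) \<one>\<^bsub>trace_monoid \<Sigma> I\<^esub>"

text \<open>Meaningful for nonempty traces only.\<close>

definition cartier_foata :: "'a set \<Rightarrow> 'a rel \<Rightarrow> 'a list set \<Rightarrow> 'a set list" where
  "cartier_foata \<Sigma> I u = (THE cs. is_cartier_foata \<Sigma> I u cs)"

definition height :: "'a set \<Rightarrow> 'a rel \<Rightarrow> 'a list set \<Rightarrow> nat" where
  "height \<Sigma> I u =
    (if u = \<one>\<^bsub>trace_monoid \<Sigma> I\<^esub> then 0 else length (cartier_foata \<Sigma> I u))"

definition graded_moebius ::
  "'a set \<Rightarrow> 'a rel \<Rightarrow> ('a list set \<Rightarrow> real) \<Rightarrow> 'a list set \<Rightarrow> real" where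
  "graded_moebius \<Sigma> I F u =
    (if u = \<one>\<^bsub>trace_monoid \<Sigma> I\<^esub>
     then \<Sum>c\<in>cliques \<Sigma> I. (- 1) ^ card c * F (clique_trace \<Sigma> I c)
     else let c = last (cartier_foata \<Sigma> I u);
              v = (THE v. v \<in> carrier (trace_monoid \<Sigma> I) \<and>
                     u = v \<otimes>\<^bsub>trace_monoid \<Sigma> I\<^esub> clique_trace \<Sigma> I c)
          in \<Sum>c'\<in>{c'\<in>cliques \<Sigma> I. c \<subseteq> c'}.
               (- 1) ^ (card c' - card c) *
               F (v \<otimes>\<^bsub>trace_monoid \<Sigma> I\<^esub> clique_trace \<Sigma> I c'))"

text \<open>The prefix order \<open>u \<le> x\<close> of traces is left divisibility in the trace monoid.\<close>

definition same_height_above :: "'a set \<Rightarrow> 'a rel \<Rightarrow> 'a list set \<Rightarrow> 'a list set set" where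
  "same_height_above \<Sigma> I u =
    (if u = \<one>\<^bsub>trace_monoid \<Sigma> I\<^esub>
     then clique_trace \<Sigma> I ` cliques \<Sigma> I
     else {x \<in> carrier (trace_monoid \<Sigma> I).
             height \<Sigma> I x = height \<Sigma> I u \<and> u divides\<^bsub>trace_monoid \<Sigma> I\<^esub> x})"

end

theory Submission
  imports Defs
begin

text \<open>A clique \<open>e\<close> extends the last clique \<open>c\<close> of \<open>x = v \<cdot> c\<close> (disjointly, to a clique) exactly when
  multiplying \<open>x\<close> by \<open>e\<close> does not increase the height. Hence, for \<open>x \<noteq> 0\<close>, \<open>H x\<close> is the sum of
  \<open>(-1)^|e| F (x \<cdot> e)\<close> over all cliques \<open>e\<close> with \<open>\<tau> (x \<cdot> e) = \<tau> x\<close>. Summing over \<open>x \<ge> u\<close> of the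
  height of \<open>u\<close> and exchanging summations, the coefficient of \<open>F z\<close> for \<open>z = u \<cdot> y\<close> is the sum of
  \<open>(-1)^|e|\<close> over the cliques \<open>e\<close> that are right divisors of \<open>y\<close>; by cancellativity these are exactly
  the subsets of the set of last letters of \<open>y\<close>, so the coefficient vanishes unless \<open>y = 0\<close>. For \<open>u = 0\<close>
  the same argument runs over the traces of height at most 1.\<close>

section \<open>Words and the trace congruence\<close>

lemma trace_cong_set: "(v, w) \<in> trace_cong \<Sigma> I \<Longrightarrow> set v = set w"
  by (induction rule: trace_cong.induct) auto

text \<open>Congruent factors have the same letters, so in a concatenation the deletion hits the
  same factor on both sides. Cancellation follows from this without any analysis of
  derivations.\<close>

lemma trace_cong_remove1:
  "(v, w) \<in> trace_cong \<Sigma> I \<Longrightarrow> (remove1 a v, remove1 a w) \<in> trace_cong \<Sigma> I"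
proof (induction rule: trace_cong.induct)
  case (commute b c)
  then show ?case by (auto intro: trace_cong.refl trace_cong.commute)
next
  case (refl w)
  then show ?case using set_remove1_subset[of a w] by (intro trace_cong.refl) auto
next
  case (append v v' w w')
  have "set v = set v'" by (rule trace_cong_set[OF append.hyps(1)])
  then show ?case
    using append by (simp add: remove1_append trace_cong.append)
qed (rule trace_cong.sym trace_cong.trans, assumption+)+

text \<open>The generating pairs are stable under reversal; results on prefixes and first letters
  thereby transfer to suffixes and last letters.\<close>

lemma trace_cong_rev:
  assumes "Relation.sym I"
  shows "(v, w) \<in> trace_cong \<Sigma> I \<Longrightarrow> (rev v, rev w) \<in> trace_cong \<Sigma> I"
proof (induction rule: trace_cong.induct)
  case (commute a b)
  then show ?case using symD[OF assms] by (auto intro: trace_cong.commute)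
next
  case (append v v' w w')
  then show ?case by (simp add: trace_cong.append)
qed (auto intro: trace_cong.refl trace_cong.sym, rule trace_cong.trans)

text \<open>At most one letter of a generating pair survives the filter: two survivors would be
  distinct by irreflexivity, which would make \<open>a\<close> and \<open>b\<close>
  independent.\<close>

lemma trace_cong_filter_dependent:
  assumes "Relation.sym I" "irrefl I" "(a, b) \<notin> I"
  shows "(v, w) \<in> trace_cong \<Sigma> I \<Longrightarrow>
    filter (\<lambda>x. x = a \<or> x = b) v = filter (\<lambda>x. x = a \<or> x = b) w"
  by (induction rule: trace_cong.induct)
    (use assms in \<open>auto dest: symD simp: irrefl_def\<close>)

section \<open>Cancellation and extremal letters of words\<close>

lemma trace_cong_append_cancel_left:
  assumes "(u @ v, u @ w) \<in> trace_cong \<Sigma> I"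
  shows "(v, w) \<in> trace_cong \<Sigma> I"
  using assms
proof (induction u)
  case (Cons a u)
  then show ?case using trace_cong_remove1[of "(a # u) @ v" "(a # u) @ w" \<Sigma> I a] by simp
qed simp

lemma trace_cong_append_cancel_right:
  assumes "Relation.sym I" "(v @ u, w @ u) \<in> trace_cong \<Sigma> I"
  shows "(v, w) \<in> trace_cong \<Sigma> I"
  using trace_cong_rev[OF assms(1) trace_cong_append_cancel_left[of "rev u" "rev v" "rev w"]]
    trace_cong_rev[OF assms] by simp

text \<open>Projected to a dependent pair, congruent words coincide, but these two projections would
  start with different letters.\<close>

lemma first_letters_independent:
  assumes "Relation.sym I" "irrefl I"
    and "(w, a # v) \<in> trace_cong \<Sigma> I" "(w, b # v') \<in> trace_cong \<Sigma> I" "a \<noteq> b"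
  shows "(a, b) \<in> I"
proof (rule ccontr)
  assume "(a, b) \<notin> I"
  moreover have "(a # v, b # v') \<in> trace_cong \<Sigma> I"
    by (rule trace_cong.trans[OF trace_cong.sym[OF assms(3)] assms(4)])
  ultimately show False
    using trace_cong_filter_dependent[OF assms(1,2), of a b "a # v" "b # v'" \<Sigma>] assms(5) by simp
qed

lemma last_letters_independent:
  assumes "Relation.sym I" "irrefl I"
    and "(w, v @ [a]) \<in> trace_cong \<Sigma> I" "(w, v' @ [b]) \<in> trace_cong \<Sigma> I" "a \<noteq> b"
  shows "(a, b) \<in> I"
  using first_letters_independent[OF assms(1,2), of "rev w" a "rev v" \<Sigma> b "rev v'"]
    trace_cong_rev[OF assms(1,3)] trace_cong_rev[OF assms(1,4)] assms(5) by simp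

lemma first_letters_prefix:
  assumes "distinct e" "w \<in> lists \<Sigma>" "\<forall>a\<in>set e. \<exists>v. (w, a # v) \<in> trace_cong \<Sigma> I"
  shows "\<exists>y. (w, e @ y) \<in> trace_cong \<Sigma> I"
  using assms
proof (induction e)
  case Nil
  then show ?case by (auto intro: trace_cong.refl)
next
  case (Cons a e)
  then obtain y v where y: "(w, e @ y) \<in> trace_cong \<Sigma> I" and v: "(w, a # v) \<in> trace_cong \<Sigma> I"
    by auto
  have "(a # v, e @ y) \<in> trace_cong \<Sigma> I"
    by (rule trace_cong.trans[OF trace_cong.sym[OF v] y])
  \<comment> \<open>Since \<open>a\<close> is not in \<open>e\<close>, deleting the first
    \<open>a\<close> removes the head on the left and a letter of \<open>y\<close> on the
    right.\<close>
  then have "(v, e @ remove1 a y) \<in> trace_cong \<Sigma> I"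
    using trace_cong_remove1[of "a # v" "e @ y" \<Sigma> I a] Cons.prems by (simp add: remove1_append)
  moreover have "a \<in> \<Sigma>"
    using trace_cong_in_lists[OF v] by simp
  ultimately have "([a] @ v, [a] @ e @ remove1 a y) \<in> trace_cong \<Sigma> I"
    by (intro trace_cong.append trace_cong.refl) auto
  then have "(w, (a # e) @ remove1 a y) \<in> trace_cong \<Sigma> I"
    using trace_cong.trans[OF v] by simp
  then show ?case by blast
qed

lemma last_letters_suffix:
  assumes "Relation.sym I" "distinct e" "w \<in> lists \<Sigma>"
    and "\<forall>a\<in>set e. \<exists>v. (w, v @ [a]) \<in> trace_cong \<Sigma> I"
  shows "\<exists>y. (w, y @ e) \<in> trace_cong \<Sigma> I"
proof -
  have "\<exists>v. (rev w, a # v) \<in> trace_cong \<Sigma> I" if "a \<in> set (rev e)" for a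
    using assms(4) that trace_cong_rev[OF assms(1)] by fastforce
  then obtain y where "(rev w, rev e @ y) \<in> trace_cong \<Sigma> I"
    using first_letters_prefix[of "rev e" "rev w" \<Sigma> I] assms(2,3)
    by (auto simp: in_lists_conv_set)
  then have "(w, rev y @ e) \<in> trace_cong \<Sigma> I"
    using trace_cong_rev[OF assms(1), of "rev w"] by fastforce
  then show ?thesis by blast
qed

section \<open>Heaps of pieces\<close>

text \<open>A word is turned into a heap by dropping its letters one after the other: a letter lands just
  above the highest piece that does not commute with it. The layers of the heap, numbered from 1,
  are the cliques of the Cartier--Foata decomposition.\<close>

definition level :: "'a rel \<Rightarrow> (nat \<times> 'a) set \<Rightarrow> 'a \<Rightarrow> nat" where
  "level I P a = Max (insert 0 {i. \<exists>b. (i, b) \<in> P \<and> (b, a) \<notin> I})"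

definition drop_piece :: "'a rel \<Rightarrow> (nat \<times> 'a) set \<Rightarrow> 'a \<Rightarrow> (nat \<times> 'a) set" where
  "drop_piece I P a = insert (Suc (level I P a), a) P"

definition heap :: "'a rel \<Rightarrow> 'a list \<Rightarrow> (nat \<times> 'a) set" where
  "heap I w = foldl (drop_piece I) {} w"

text \<open>The inserted 0, as in \<open>level\<close>, is the floor: the empty heap has height 0,
  and a piece with nothing dependent below it lands in layer 1.\<close>

definition heap_height :: "(nat \<times> 'a) set \<Rightarrow> nat" where
  "heap_height P = Max (insert 0 (fst ` P))"

definition layer :: "(nat \<times> 'a) set \<Rightarrow> nat \<Rightarrow> 'a set" where
  "layer P i = {a. (i, a) \<in> P}"

definition layers :: "(nat \<times> 'a) set \<Rightarrow> 'a set list" where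
  "layers P = map (\<lambda>i. layer P (Suc i)) [0..<heap_height P]"

lemma heap_Nil [simp]: "heap I [] = {}"
  by (simp add: heap_def)

lemma heap_snoc: "heap I (w @ [a]) = drop_piece I (heap I w) a"
  by (simp add: heap_def)

lemma finite_heap [simp]: "finite (heap I w)"
  by (induction w rule: rev_induct) (simp_all add: heap_snoc drop_piece_def)

lemma fst_heap_le_height: "finite P \<Longrightarrow> (i, a) \<in> P \<Longrightarrow> i \<le> heap_height P"
  unfolding heap_height_def by (rule Max_ge) force+

lemma heap_height_mono: "finite Q \<Longrightarrow> P \<subseteq> Q \<Longrightarrow> heap_height P \<le> heap_height Q"
  unfolding heap_height_def by (rule Max_mono) auto

lemma heap_height_layer:
  assumes "finite P" "heap_height P > 0"
  shows "layer P (heap_height P) \<noteq> {}"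
proof -
  have "heap_height P \<in> insert 0 (fst ` P)"
    unfolding heap_height_def by (rule Max_in) (use assms in auto)
  then show ?thesis using assms by (force simp: layer_def)
qed

lemma finite_level_set: "finite P \<Longrightarrow> finite {i. \<exists>b. (i, b) \<in> P \<and> (b, a) \<notin> I}"
  by (rule finite_subset[of _ "fst ` P"]) force+

lemma level_ge: "finite P \<Longrightarrow> (i, b) \<in> P \<Longrightarrow> (b, a) \<notin> I \<Longrightarrow> i \<le> level I P a"
  unfolding level_def by (rule Max_ge) (auto simp: finite_level_set)

lemma level_witness:
  assumes "finite P" "level I P a > 0"
  shows "\<exists>b. (level I P a, b) \<in> P \<and> (b, a) \<notin> I"
proof -
  have "level I P a \<in> insert 0 {i. \<exists>b. (i, b) \<in> P \<and> (b, a) \<notin> I}"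
    unfolding level_def by (rule Max_in) (auto simp: finite_level_set assms)
  then show ?thesis using assms by auto
qed

lemma level_le_height: "finite P \<Longrightarrow> level I P a \<le> heap_height P"
  using level_witness fst_heap_le_height by (metis neq0_conv zero_le)

section \<open>Heaps as invariants of traces\<close>

lemma level_insert_independent: "(b, a) \<in> I \<Longrightarrow> level I (insert (i, b) P) a = level I P a"
  unfolding level_def by (rule arg_cong[where f = "\<lambda>X. Max (insert 0 X)"]) auto

text \<open>Independent letters do not see each other, so either order of dropping adds the same two
  pieces. The initial heap \<open>P\<close> is arbitrary because in a concatenation the second
  factor falls onto the heap of the first.\<close>

lemma foldl_drop_piece_cong:
  assumes "Relation.sym I"
  shows "(v, w) \<in> trace_cong \<Sigma> I \<Longrightarrow> foldl (drop_piece I) P v = foldl (drop_piece I) P w"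
proof (induction arbitrary: P rule: trace_cong.induct)
  case (commute a b)
  then have "(a, b) \<in> I" "(b, a) \<in> I"
    using symD[OF assms] by auto
  then show ?case
    by (auto simp: drop_piece_def level_insert_independent)
qed auto

lemma heap_cong: "Relation.sym I \<Longrightarrow> (v, w) \<in> trace_cong \<Sigma> I \<Longrightarrow> heap I v = heap I w"
  by (simp add: heap_def foldl_drop_piece_cong)

section \<open>Layers: independence, support and nonemptiness\<close>

lemma heap_letters: "(i, a) \<in> heap I w \<Longrightarrow> a \<in> set w"
  by (induction w rule: rev_induct) (auto simp: heap_snoc drop_piece_def)

lemma heap_height_eq_0_iff: "heap_height (heap I w) = 0 \<longleftrightarrow> w = []"
proof (cases w rule: rev_cases)
  case Nil
  then show ?thesis by (simp add: heap_height_def)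
next
  case (snoc v a)
  have "Suc (level I (heap I v) a) \<le> heap_height (heap I w)"
    by (rule fst_heap_le_height[where a = a]) (simp_all add: snoc heap_snoc drop_piece_def)
  then show ?thesis using snoc by simp
qed

text \<open>A piece lands strictly above all pieces dependent on it, so it is independent of
  whatever its layer already holds.\<close>

lemma heap_layer_independent:
  assumes "Relation.sym I" "(i, a) \<in> heap I w" "(i, b) \<in> heap I w" "a \<noteq> b"
  shows "(a, b) \<in> I"
  using assms(2,3)
proof (induction w rule: rev_induct)
  case (snoc c w)
  have *: "(d, c) \<in> I" if "(Suc (level I (heap I w) c), d) \<in> heap I w" for d
    using level_ge[OF finite_heap that] by fastforce
  show ?case
    using snoc assms(4) * symD[OF assms(1)] by (auto simp: heap_snoc drop_piece_def)
qed simp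

text \<open>The supporting piece is the one at which the maximum in \<open>level\<close> was
  attained. This is the relation \<open>clique_arrow\<close> between consecutive layers.\<close>

lemma heap_layer_supported:
  "(Suc i, a) \<in> heap I w \<Longrightarrow> i > 0 \<Longrightarrow> \<exists>b. (i, b) \<in> heap I w \<and> (b, a) \<notin> I"
proof (induction w rule: rev_induct)
  case (snoc c w)
  then show ?case
    using level_witness[OF finite_heap, of I I w c] by (auto simp: heap_snoc drop_piece_def)
qed simp

text \<open>Pairwise independent letters do not support each other, so all their levels can be
  computed in the initial heap.\<close>

lemma foldl_drop_piece_clique:
  assumes "distinct v" "\<forall>a\<in>set v. \<forall>b\<in>set v. a \<noteq> b \<longrightarrow> (a, b) \<in> I"
  shows "foldl (drop_piece I) P v = P \<union> (\<lambda>a. (Suc (level I P a), a)) ` set v"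
  using assms
proof (induction v rule: rev_induct)
  case (snoc c v)
  have "level I (P \<union> (\<lambda>a. (Suc (level I P a), a)) ` set v) c = level I P c"
    unfolding level_def
    by (rule arg_cong[where f = "\<lambda>X. Max (insert 0 X)"]) (use snoc.prems in auto)
  then show ?case using snoc by (auto simp: drop_piece_def)
qed simp

lemma heap_append_subset: "heap I v \<subseteq> heap I (v @ w)"
proof (induction w rule: rev_induct)
  case (snoc a w)
  then show ?case using heap_snoc[of I "v @ w" a] by (auto simp: drop_piece_def)
qed simp

text \<open>Descending induction from the top layer: every piece above layer 1 rests on a piece one
  layer below.\<close>

lemma heap_layer_nonempty:
  "0 < i \<Longrightarrow> i \<le> heap_height (heap I w) \<Longrightarrow> layer (heap I w) i \<noteq> {}"
proof (induction "heap_height (heap I w) - i" arbitrary: i)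
  case 0
  then show ?case using heap_height_layer[OF finite_heap, of I w] by simp
next
  case (Suc k)
  then have "layer (heap I w) (Suc i) \<noteq> {}" by simp
  then obtain a where "(Suc i, a) \<in> heap I w" by (auto simp: layer_def)
  then show ?case using heap_layer_supported[of i a I w] Suc.prems by (auto simp: layer_def)
qed

lemma layers_nonempty: "{} \<notin> set (layers (heap I w))"
proof
  assume "{} \<in> set (layers (heap I w))"
  then obtain i where "i < heap_height (heap I w)" "layer (heap I w) (Suc i) = {}"
    by (auto simp: layers_def)
  then show False using heap_layer_nonempty[of "Suc i" I w] by simp
qed

lemma layers_successively: "successively (clique_arrow I) (layers (heap I w))"
proof -
  have "clique_arrow I (layer (heap I w) (Suc i)) (layer (heap I w) (Suc (Suc i)))" for i
    using heap_layer_supported[of "Suc i" _ I w] by (auto simp: clique_arrow_def layer_def)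
  then show ?thesis
    by (simp add: successively_conv_nth layers_def)
qed

section \<open>The Cartier--Foata decomposition\<close>

text \<open>The same choice as inside \<open>clique_trace\<close>, so that clique traces unfold to
  traces of these words.\<close>

definition clique_word :: "'a set \<Rightarrow> 'a list" where
  "clique_word c = (SOME w. distinct w \<and> set w = c)"

abbreviation cliques_word :: "'a set list \<Rightarrow> 'a list" where
  "cliques_word cs \<equiv> concat (map clique_word cs)"

lemma clique_word: "finite c \<Longrightarrow> distinct (clique_word c) \<and> set (clique_word c) = c"
  unfolding clique_word_def by (rule someI_ex) (metis finite_distinct_list)

lemma clique_word_empty [simp]: "clique_word {} = []"
  by (metis clique_word finite.emptyI set_empty)

lemma clique_trace_word: "clique_trace \<Sigma> I c = trace_of \<Sigma> I (clique_word c)"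
  by (simp add: clique_trace_def clique_word_def)

text \<open>Expand the product of the factors \<open>1 - 1\<close> over \<open>A\<close>; it equals
  1 only as an empty product.\<close>

lemma sum_Pow_alternating:
  fixes A :: "'b set"
  assumes "finite A"
  shows "(\<Sum>e\<in>Pow A. (- 1 :: real) ^ card e) = (if A = {} then 1 else 0)"
proof -
  have "(\<Sum>e\<in>Pow A. (- 1 :: real) ^ card e) = (\<Prod>x\<in>A. 1 - 1)"
    by (simp only: prod_diff_conv_sum[OF assms] prod.neutral_const mult_1_right)
  also have "\<dots> = (if A = {} then 1 else 0)"
    using assms by (cases "A = {}") (simp_all add: card_gt_0_iff)
  finally show ?thesis .
qed

locale independence_alphabet =
  fixes \<Sigma> :: "'a set" and I :: "'a rel"
  assumes finite_alphabet: "finite \<Sigma>"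
    and sym_independence: "Relation.sym I"
    and irrefl_independence: "irrefl I"
begin

abbreviation M :: "'a list set monoid" where "M \<equiv> trace_monoid \<Sigma> I"
abbreviation tr :: "'a list \<Rightarrow> 'a list set" where "tr \<equiv> trace_of \<Sigma> I"
abbreviation cl :: "'a set \<Rightarrow> 'a list set" where "cl \<equiv> clique_trace \<Sigma> I"

sublocale monoid M
  by (rule monoid_trace_monoid)

lemma finite_clique: "c \<in> cliques \<Sigma> I \<Longrightarrow> finite c"
  using finite_alphabet by (auto simp: cliques_def intro: finite_subset)

lemma finite_cliques: "finite (cliques \<Sigma> I)"
  by (rule finite_subset[of _ "Pow \<Sigma>"]) (auto simp: cliques_def finite_alphabet)

lemma clique_word_clique:
  assumes "c \<in> cliques \<Sigma> I"
  shows "distinct (clique_word c)" "set (clique_word c) = c" "clique_word c \<in> lists \<Sigma>"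
  using clique_word[OF finite_clique[OF assms]] assms by (auto simp: cliques_def)

lemma cliques_word_in_lists: "set cs \<subseteq> cliques \<Sigma> I \<Longrightarrow> cliques_word cs \<in> lists \<Sigma>"
  using clique_word_clique(3) by (induction cs) auto

lemma cl_in_carrier: "c \<in> cliques \<Sigma> I \<Longrightarrow> cl c \<in> carrier M"
  by (auto simp: clique_trace_word carrier_trace_monoid clique_word_clique)

lemma foldr_mult_cliques:
  assumes "set cs \<subseteq> cliques \<Sigma> I"
  shows "foldr (mult M) (map cl cs) \<one>\<^bsub>M\<^esub> = tr (cliques_word cs)"
  using assms
proof (induction cs)
  case Nil
  then show ?case by (simp add: one_trace_monoid)
next
  case (Cons c cs)
  then show ?case
    using mult_trace_monoid[of "clique_word c" \<Sigma> "cliques_word cs" I]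
      clique_word_clique(3)[of c] cliques_word_in_lists[of cs]
    by (simp add: clique_trace_word)
qed

text \<open>By the arrow relation each letter of the next clique rests on the layer formed by the
  previous one, so a decomposition can be read off the heap of its word. This is the source of
  uniqueness.\<close>

lemma heap_cliques_word:
  assumes "set cs \<subseteq> cliques \<Sigma> I" "successively (clique_arrow I) cs"
  shows "heap I (cliques_word cs) = (\<Union>i<length cs. {Suc i} \<times> cs ! i)"
  using assms
proof (induction cs rule: rev_induct)
  case (snoc c cs)
  define P where "P = heap I (cliques_word cs)"
  have P: "P = (\<Union>i<length cs. {Suc i} \<times> cs ! i)"
    unfolding P_def by (rule snoc.IH) (use snoc.prems in \<open>simp_all add: successively_append_iff\<close>)
  have fin: "finite P"
    by (simp add: P_def)
  have c: "c \<in> cliques \<Sigma> I" using snoc.prems by simp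
  \<comment> \<open>The arrow from the last clique bounds the level from below, the number of layers
    built so far from above.\<close>
  have level: "level I P a = length cs" if a: "a \<in> c" for a
  proof (cases cs rule: rev_cases)
    case Nil
    then show ?thesis by (simp add: level_def P)
  next
    case (snoc ds d)
    have "clique_arrow I d c"
      using \<open>successively (clique_arrow I) (cs @ [c])\<close> snoc by (simp add: successively_append_iff)
    then obtain b where "b \<in> d" "(b, a) \<notin> I"
      using a by (auto simp: clique_arrow_def)
    then have "length cs \<le> level I P a"
      by (intro level_ge[OF fin, of _ b]) (auto simp: snoc P)
    moreover have "i \<le> length cs" if "(i, b) \<in> P" for i b
      using that by (auto simp: P)
    then have "level I P a \<le> length cs"
      using level_witness[OF fin, of I a] by (cases "level I P a = 0") auto
    ultimately show ?thesis by simp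
  qed
  have "heap I (cliques_word (cs @ [c])) = P \<union> (\<lambda>a. (Suc (level I P a), a)) ` c"
    using foldl_drop_piece_clique[of "clique_word c" I P] clique_word_clique[OF c] c
    by (simp add: heap_def cliques_def P_def)
  also have "(\<lambda>a. (Suc (level I P a), a)) ` c = {Suc (length cs)} \<times> c"
    by (auto simp: level)
  also have "P \<union> {Suc (length cs)} \<times> c = (\<Union>i<length (cs @ [c]). {Suc i} \<times> (cs @ [c]) ! i)"
    by (simp add: P lessThan_Suc nth_append Un_commute)
  finally show ?case .
qed simp

lemma layers_cliques_word:
  assumes "set cs \<subseteq> cliques \<Sigma> I - {{}}" "successively (clique_arrow I) cs"
  shows "layers (heap I (cliques_word cs)) = cs"
proof -
  let ?P = "heap I (cliques_word cs)"
  have P: "?P = (\<Union>i<length cs. {Suc i} \<times> cs ! i)"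
    using assms by (intro heap_cliques_word) auto
  have "heap_height ?P = length cs"
  proof (rule antisym)
    show "heap_height ?P \<le> length cs"
      unfolding heap_height_def by (subst Max_le_iff) (simp, simp, use P in auto)
    \<comment> \<open>Nonemptiness of the last clique guarantees a piece at height
      \<open>length cs\<close>.\<close>
    show "length cs \<le> heap_height ?P"
    proof (cases cs rule: rev_cases)
      case (snoc ds d)
      then obtain a where "a \<in> d" using assms(1) by auto
      then have "(length cs, a) \<in> ?P" unfolding P by (auto simp: snoc)
      then show ?thesis by (rule fst_heap_le_height[OF finite_heap])
    qed simp
  qed
  then show ?thesis
    by (intro nth_equalityI) (simp_all add: layers_def layer_def P)
qed

lemma layer_heap_in_cliques:
  assumes "w \<in> lists \<Sigma>"
  shows "layer (heap I w) i \<in> cliques \<Sigma> I"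
proof -
  have "layer (heap I w) i \<subseteq> \<Sigma>"
    using assms heap_letters[of i _ I w] by (auto simp: layer_def in_lists_conv_set)
  then show ?thesis
    using heap_layer_independent[OF sym_independence, of i _ w] by (auto simp: layer_def cliques_def)
qed

lemma layers_in_cliques: "w \<in> lists \<Sigma> \<Longrightarrow> set (layers (heap I w)) \<subseteq> cliques \<Sigma> I"
  using layer_heap_in_cliques by (auto simp: layers_def)

text \<open>The dropped letter commutes with every layer above the one where it lands.\<close>

lemma trace_cong_layers:
  assumes "w \<in> lists \<Sigma>"
  shows "(w, cliques_word (layers (heap I w))) \<in> trace_cong \<Sigma> I"
  using assms
proof (induction w rule: rev_induct)
  case Nil
  then show ?case by (simp add: layers_def heap_height_def trace_cong.refl)
next
  case (snoc a w)
  define P where "P = heap I w"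
  define k where "k = level I P a"
  define n where "n = heap_height P"
  let ?Q = "drop_piece I P a"
  \<comment> \<open>\<open>?L P i j\<close> spells the layers \<open>Suc i\<close> to
    \<open>j\<close>; the layer that receives \<open>a\<close> has number \<open>Suc k\<close>,
    hence list index \<open>k\<close>.\<close>
  let ?L = "\<lambda>P k n. cliques_word (map (\<lambda>i. layer P (Suc i)) [k..<n])"
  have w: "w \<in> lists \<Sigma>" and a: "a \<in> \<Sigma>" using snoc.prems by auto
  have finP: "finite P" by (simp add: P_def)
  have k: "k \<le> n" unfolding k_def n_def by (rule level_le_height[OF finP])
  have above: "(b, a) \<in> I" if "(i, b) \<in> P" "k < i" for i b
    using level_ge[OF finP that(1)] that(2) unfolding k_def by fastforce
  have cliqueP: "layer P i \<in> cliques \<Sigma> I" for i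
    unfolding P_def by (rule layer_heap_in_cliques[OF w])
  have Q: "?Q = heap I (w @ [a])" by (simp add: P_def heap_snoc)
  have cliqueQ: "layer ?Q i \<in> cliques \<Sigma> I" for i
    unfolding Q by (rule layer_heap_in_cliques[OF snoc.prems])
  have layerQ: "layer ?Q i = (if i = Suc k then insert a (layer P i) else layer P i)" for i
    by (auto simp: layer_def drop_piece_def k_def)
  \<comment> \<open>If \<open>k = n\<close> then \<open>a\<close> opens a new top layer
    \<open>Suc k\<close>, otherwise the height stays \<open>n\<close>; the maximum covers both
    cases.\<close>
  have hQ: "heap_height ?Q = max (Suc k) n"
  proof -
    have "insert 0 (fst ` ?Q) = insert (Suc k) (insert 0 (fst ` P))"
      by (auto simp: drop_piece_def k_def)
    then show ?thesis
      unfolding heap_height_def n_def using finP Max_insert[of "insert 0 (fst ` P)" "Suc k"] by simp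
  qed
  have inL: "?L P i j \<in> lists \<Sigma>" for i j
    by (rule cliques_word_in_lists) (use cliqueP in auto)
  \<comment> \<open>A copy of \<open>a\<close> above level \<open>k\<close> would be independent of
    itself.\<close>
  have aP: "a \<notin> layer P (Suc k)"
    using above[of "Suc k" a] irrefl_independence by (auto simp: layer_def irrefl_def)
  have "(w, ?L P 0 n) \<in> trace_cong \<Sigma> I"
    using snoc.IH w by (simp add: layers_def P_def n_def)
  then have 1: "(w @ [a], ?L P 0 n @ [a]) \<in> trace_cong \<Sigma> I"
    using a by (intro trace_cong.append trace_cong.refl) auto
  have 2: "(clique_word (layer P (Suc k)) @ [a], clique_word (layer ?Q (Suc k))) \<in> trace_cong \<Sigma> I"
  proof (rule trace_cong_enumerations)
    show "distinct (clique_word (layer ?Q (Suc k)))"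
      by (rule clique_word_clique[OF cliqueQ])
  qed (use clique_word_clique[OF cliqueP, of "Suc k"] clique_word_clique[OF cliqueQ, of "Suc k"]
      cliqueQ[of "Suc k"] layerQ[of "Suc k"] aP in auto)
  have L0: "?L ?Q 0 k = ?L P 0 k"
    by (intro arg_cong[where f = concat]) (auto simp: layerQ)
  have L1: "?L ?Q (Suc k) j = ?L P (Suc k) j" for j
    by (intro arg_cong[where f = concat]) (auto simp: layerQ)
  have split0: "[0..<max (Suc k) n] = [0..<k] @ k # [Suc k..<max (Suc k) n]"
    by (metis le_add_same_cancel1 less_max_iff_disj lessI upt_add_eq_append upt_conv_Cons
        le_add_diff_inverse less_imp_le_nat zero_le)
  have split: "?L ?Q 0 (max (Suc k) n) =
      ?L P 0 k @ clique_word (layer ?Q (Suc k)) @ ?L P (Suc k) (max (Suc k) n)"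
    unfolding split0 using L0 L1 by simp
  have "(?L P 0 n @ [a], ?L ?Q 0 (max (Suc k) n)) \<in> trace_cong \<Sigma> I"
  proof (cases "k = n")
    \<comment> \<open>The layer that receives \<open>a\<close> was empty and nothing lies above
      it.\<close>
    case True
    then have "layer P (Suc k) = {}"
      using fst_heap_le_height[OF finP, of "Suc k"] by (auto simp: layer_def n_def)
    then have "(?L P 0 k @ [a], ?L P 0 k @ clique_word (layer ?Q (Suc k))) \<in> trace_cong \<Sigma> I"
      using 2 inL by (intro trace_cong.append trace_cong.refl) auto
    then show ?thesis unfolding split using True by simp
  next
    \<comment> \<open>Here \<open>a\<close> moves left past the layers above \<open>Suc k\<close>
      and is then absorbed into the word of layer \<open>Suc k\<close>.\<close>
    case False
    then have n: "max (Suc k) n = n" using k by simp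
    have L: "?L P 0 n = ?L P 0 k @ clique_word (layer P (Suc k)) @ ?L P (Suc k) n"
      using split0 unfolding n by simp
    have "set (?L P (Suc k) n) \<subseteq> \<Sigma>" using inL[of "Suc k" n] by auto
    moreover have "\<forall>b\<in>set (?L P (Suc k) n). (b, a) \<in> I"
      using above clique_word_clique(2)[OF cliqueP] by (auto simp: layer_def)
    ultimately have "(?L P (Suc k) n @ [a], a # ?L P (Suc k) n) \<in> trace_cong \<Sigma> I"
      by (intro trace_cong_move_front a)
    then have "(?L P 0 k @ clique_word (layer P (Suc k)) @ ?L P (Suc k) n @ [a],
        ?L P 0 k @ clique_word (layer P (Suc k)) @ a # ?L P (Suc k) n) \<in> trace_cong \<Sigma> I"
      by (intro trace_cong.append trace_cong.refl inL clique_word_clique(3) cliqueP)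
    moreover have "(?L P 0 k @ (clique_word (layer P (Suc k)) @ [a]) @ ?L P (Suc k) n,
        ?L P 0 k @ clique_word (layer ?Q (Suc k)) @ ?L P (Suc k) n) \<in> trace_cong \<Sigma> I"
      by (intro trace_cong.append trace_cong.refl inL 2)
    ultimately show ?thesis
      using trace_cong.trans unfolding split[unfolded n] n L by fastforce
  qed
  then have "(w @ [a], ?L ?Q 0 (max (Suc k) n)) \<in> trace_cong \<Sigma> I"
    by (rule trace_cong.trans[OF 1])
  then show ?case
    by (simp add: layers_def hQ flip: Q)
qed

section \<open>Existence and uniqueness of the decomposition, and the height\<close>

lemma tr_layers: "w \<in> lists \<Sigma> \<Longrightarrow> tr w = tr (cliques_word (layers (heap I w)))"
  using trace_cong_layers trace_of_eq_iff trace_cong_in_lists by metis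

lemma tr_eq_one_iff: "w \<in> lists \<Sigma> \<Longrightarrow> tr w = \<one>\<^bsub>M\<^esub> \<longleftrightarrow> w = []"
  using trace_cong_set[of w "[]" \<Sigma> I] by (auto simp: one_trace_monoid trace_of_eq_iff intro: trace_cong.refl)

text \<open>Uniqueness: the word of any decomposition has the same heap as \<open>w\<close>, and the
  layers of that heap give the decomposition back. Existence: \<open>w\<close> is congruent to the
  word of its layers.\<close>

lemma is_cartier_foata_iff:
  assumes "w \<in> lists \<Sigma>" "w \<noteq> []"
  shows "is_cartier_foata \<Sigma> I (tr w) cs \<longleftrightarrow> cs = layers (heap I w)"
proof
  assume cf: "is_cartier_foata \<Sigma> I (tr w) cs"
  then have cs: "set cs \<subseteq> cliques \<Sigma> I" by (auto simp: is_cartier_foata_def)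
  then have "tr w = tr (cliques_word cs)"
    using cf by (simp add: is_cartier_foata_def foldr_mult_cliques)
  then have "(w, cliques_word cs) \<in> trace_cong \<Sigma> I"
    using assms cliques_word_in_lists[OF cs] by (simp add: trace_of_eq_iff)
  then show "cs = layers (heap I w)"
    using heap_cong[OF sym_independence] layers_cliques_word cf
    by (metis is_cartier_foata_def)
next
  assume cs: "cs = layers (heap I w)"
  have "cs \<noteq> []"
    using assms(2) by (simp add: cs layers_def heap_height_eq_0_iff)
  then show "is_cartier_foata \<Sigma> I (tr w) cs"
    using cs layers_in_cliques[OF assms(1)] layers_nonempty[of I w] layers_successively[of I w]
      tr_layers[OF assms(1)]
    by (auto simp: is_cartier_foata_def foldr_mult_cliques)
qed

lemma cartier_foata_tr:
  "w \<in> lists \<Sigma> \<Longrightarrow> w \<noteq> [] \<Longrightarrow> cartier_foata \<Sigma> I (tr w) = layers (heap I w)"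
  by (simp add: cartier_foata_def is_cartier_foata_iff)

lemma height_tr: "w \<in> lists \<Sigma> \<Longrightarrow> height \<Sigma> I (tr w) = heap_height (heap I w)"
  by (auto simp: height_def tr_eq_one_iff cartier_foata_tr layers_def heap_height_def)

text \<open>Dropping further letters only adds pieces to the heap.\<close>

lemma height_le_mult:
  assumes "x \<in> carrier M" "y \<in> carrier M"
  shows "height \<Sigma> I x \<le> height \<Sigma> I (x \<otimes>\<^bsub>M\<^esub> y)"
proof -
  obtain v w where "x = tr v" "y = tr w" "v \<in> lists \<Sigma>" "w \<in> lists \<Sigma>"
    using assms by (auto simp: carrier_trace_monoid)
  then show ?thesis
    using heap_height_mono[OF finite_heap heap_append_subset, of I v w]
    by (simp add: mult_trace_monoid height_tr)
qed

text \<open>A trace is recovered from its heap, which for height at most \<open>n\<close> is a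
  subset of the finite set \<open>{..n} \<times> \<Sigma>\<close>.\<close>

lemma finite_height_le: "finite {x \<in> carrier M. height \<Sigma> I x \<le> n}"
proof (rule finite_surj)
  show "finite (Pow ({..n} \<times> \<Sigma>))" using finite_alphabet by simp
  show "{x \<in> carrier M. height \<Sigma> I x \<le> n} \<subseteq>
      (\<lambda>P. tr (cliques_word (layers P))) ` Pow ({..n} \<times> \<Sigma>)"
  proof clarify
    fix x assume "x \<in> carrier M" "height \<Sigma> I x \<le> n"
    then obtain w where w: "x = tr w" "w \<in> lists \<Sigma>" "heap_height (heap I w) \<le> n"
      by (auto simp: carrier_trace_monoid height_tr in_lists_conv_set)
    then have "heap I w \<subseteq> {..n} \<times> \<Sigma>"
      using fst_heap_le_height[OF finite_heap, of _ _ I w] heap_letters[of _ _ I w] by fastforce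
    then show "x \<in> (\<lambda>P. tr (cliques_word (layers P))) ` Pow ({..n} \<times> \<Sigma>)"
      using w tr_layers by auto
  qed
qed

text \<open>A bound on the height describes the summation range for the empty trace, which gives it
  the closure under prefixes needed for the inversion.\<close>

lemma clique_traces_eq_height_le_1:
  "cl ` cliques \<Sigma> I = {x \<in> carrier M. height \<Sigma> I x \<le> 1}"
proof (intro Set.set_eqI iffI)
  fix x assume "x \<in> cl ` cliques \<Sigma> I"
  then obtain c where c: "c \<in> cliques \<Sigma> I" and x: "x = cl c" by auto
  have "height \<Sigma> I x \<le> 1"
  proof (cases "c = {}")
    case True
    then show ?thesis by (simp add: x clique_trace_word height_tr heap_height_def)
  next
    case False
    then have "layers (heap I (cliques_word [c])) = [c]"
      using c by (intro layers_cliques_word) auto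
    then have "length (layers (heap I (clique_word c))) = 1" by simp
    then show ?thesis
      using c by (simp add: x clique_trace_word height_tr clique_word_clique layers_def)
  qed
  then show "x \<in> {x \<in> carrier M. height \<Sigma> I x \<le> 1}"
    using c x cl_in_carrier by simp
next
  fix x assume "x \<in> {x \<in> carrier M. height \<Sigma> I x \<le> 1}"
  then obtain w where w: "x = tr w" "w \<in> lists \<Sigma>" "heap_height (heap I w) \<le> 1"
    by (auto simp: carrier_trace_monoid height_tr in_lists_conv_set)
  \<comment> \<open>For the empty heap both sides are the empty word, so one formula serves heights
    0 and 1.\<close>
  have "cliques_word (layers (heap I w)) = clique_word (layer (heap I w) 1)"
  proof (cases "heap_height (heap I w) = 0")
    case True
    then show ?thesis by (simp add: layers_def layer_def heap_height_eq_0_iff)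
  next
    case False
    then have "heap_height (heap I w) = 1" using w(3) by simp
    then show ?thesis by (simp add: layers_def)
  qed
  then have "x = cl (layer (heap I w) 1)"
    using w tr_layers by (simp add: clique_trace_word)
  then show "x \<in> cl ` cliques \<Sigma> I"
    using layer_heap_in_cliques[OF w(2)] by blast
qed

section \<open>Cancellation\<close>

lemma trace_left_cancel:
  assumes "x \<in> carrier M" "y \<in> carrier M" "z \<in> carrier M" "x \<otimes>\<^bsub>M\<^esub> y = x \<otimes>\<^bsub>M\<^esub> z"
  shows "y = z"
proof -
  obtain u v w where "x = tr u" "y = tr v" "z = tr w" "u \<in> lists \<Sigma>" "v \<in> lists \<Sigma>" "w \<in> lists \<Sigma>"
    using assms(1-3) by (auto simp: carrier_trace_monoid)
  then show ?thesis
    using assms(4) trace_cong_append_cancel_left[of u v w \<Sigma> I]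
    by (simp add: mult_trace_monoid trace_of_eq_iff)
qed

lemma trace_right_cancel:
  assumes "x \<in> carrier M" "y \<in> carrier M" "z \<in> carrier M" "y \<otimes>\<^bsub>M\<^esub> x = z \<otimes>\<^bsub>M\<^esub> x"
  shows "y = z"
proof -
  obtain u v w where "x = tr u" "y = tr v" "z = tr w" "u \<in> lists \<Sigma>" "v \<in> lists \<Sigma>" "w \<in> lists \<Sigma>"
    using assms(1-3) by (auto simp: carrier_trace_monoid)
  then show ?thesis
    using assms(4) trace_cong_append_cancel_right[OF sym_independence, of v u w \<Sigma>]
    by (simp add: mult_trace_monoid trace_of_eq_iff)
qed

lemma cl_union:
  assumes "c \<union> e \<in> cliques \<Sigma> I" "c \<inter> e = {}"
  shows "cl (c \<union> e) = cl c \<otimes>\<^bsub>M\<^esub> cl e"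
proof -
  have "c \<in> cliques \<Sigma> I" "e \<in> cliques \<Sigma> I" using assms(1) by (auto simp: cliques_def)
  note ce = clique_word_clique[OF this(1)] clique_word_clique[OF this(2)]
  have "cl (c \<union> e) = tr (clique_word c @ clique_word e)"
    using ce assms by (intro clique_trace_eq) auto
  then show ?thesis
    using ce by (simp add: clique_trace_word mult_trace_monoid)
qed

section \<open>Last letters (the labels of the maximal elements of the trace) and clique
  suffixes\<close>

definition last_letters :: "'a list set \<Rightarrow> 'a set" where
  "last_letters x = {a. \<exists>v. v @ [a] \<in> lists \<Sigma> \<and> x = tr (v @ [a])}"

lemma last_letters_tr:
  assumes "w \<in> lists \<Sigma>"
  shows "last_letters (tr w) = {a. \<exists>v. (w, v @ [a]) \<in> trace_cong \<Sigma> I}"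
proof -
  have "v @ [a] \<in> lists \<Sigma> \<and> tr w = tr (v @ [a]) \<longleftrightarrow> (w, v @ [a]) \<in> trace_cong \<Sigma> I" for v a
    using trace_of_eq_iff[OF assms, of "v @ [a]" I] trace_cong_in_lists[of w "v @ [a]" \<Sigma> I] by metis
  then show ?thesis by (simp only: last_letters_def)
qed

lemma last_letters_empty_iff:
  assumes "x \<in> carrier M"
  shows "last_letters x = {} \<longleftrightarrow> x = \<one>\<^bsub>M\<^esub>"
proof -
  obtain w where w: "x = tr w" "w \<in> lists \<Sigma>" using assms by (auto simp: carrier_trace_monoid)
  show ?thesis
  proof (cases w rule: rev_cases)
    case Nil
    then show ?thesis
      using w trace_cong_set[of "[]" _ \<Sigma> I] by (auto simp: last_letters_tr one_trace_monoid)
  next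
    case (snoc v a)
    then show ?thesis
      using w by (auto simp: last_letters_def tr_eq_one_iff)
  qed
qed

text \<open>Any letter of a clique can be enumerated last. Conversely, last letters are pairwise
  independent and can be split off together. The cliques dividing \<open>x\<close> on the right thus
  form a full power set.\<close>

lemma clique_suffix_iff:
  assumes "x \<in> carrier M"
  shows "e \<in> cliques \<Sigma> I \<and> (\<exists>y\<in>carrier M. x = y \<otimes>\<^bsub>M\<^esub> cl e) \<longleftrightarrow> e \<subseteq> last_letters x"
proof
  assume "e \<in> cliques \<Sigma> I \<and> (\<exists>y\<in>carrier M. x = y \<otimes>\<^bsub>M\<^esub> cl e)"
  then obtain v where e: "e \<in> cliques \<Sigma> I" and v: "v \<in> lists \<Sigma>" "x = tr v \<otimes>\<^bsub>M\<^esub> cl e"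
    by (auto simp: carrier_trace_monoid)
  show "e \<subseteq> last_letters x"
  proof
    fix a assume a: "a \<in> e"
    have ea: "e - {a} \<in> cliques \<Sigma> I" using e by (auto simp: cliques_def)
    note ew = clique_word_clique[OF ea]
    have "cl e = tr (clique_word (e - {a}) @ [a])"
      using ew a e by (intro clique_trace_eq) auto
    moreover have "a \<in> \<Sigma>" using a e by (auto simp: cliques_def)
    ultimately have "x = tr ((v @ clique_word (e - {a})) @ [a])"
      using v ew by (simp add: mult_trace_monoid)
    then show "a \<in> last_letters x"
      unfolding last_letters_def
      using v ew \<open>a \<in> \<Sigma>\<close> by (intro CollectI exI[of _ "v @ clique_word (e - {a})"]) simp
  qed
next
  assume sub: "e \<subseteq> last_letters x"
  obtain w where w: "x = tr w" "w \<in> lists \<Sigma>" using assms by (auto simp: carrier_trace_monoid)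
  have *: "\<exists>v. (w, v @ [a]) \<in> trace_cong \<Sigma> I" if "a \<in> e" for a
    using that sub w by (auto simp: last_letters_tr)
  have "(a, b) \<in> I" if "a \<in> e" "b \<in> e" "a \<noteq> b" for a b
    using *[OF that(1)] *[OF that(2)] that(3)
      last_letters_independent[OF sym_independence irrefl_independence] by blast
  moreover have "e \<subseteq> \<Sigma>"
    using sub by (auto simp: last_letters_def)
  ultimately have e: "e \<in> cliques \<Sigma> I"
    by (simp add: cliques_def)
  note ew = clique_word_clique[OF e]
  obtain y where y: "(w, y @ clique_word e) \<in> trace_cong \<Sigma> I"
    using last_letters_suffix[OF sym_independence ew(1) w(2)] * ew(2) by auto
  then have "y \<in> lists \<Sigma>" "x = tr y \<otimes>\<^bsub>M\<^esub> cl e"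
    using w ew trace_cong_in_lists[OF y] trace_of_eq_iff[of w \<Sigma> "y @ clique_word e" I]
    by (auto simp: clique_trace_word mult_trace_monoid)
  then show "e \<in> cliques \<Sigma> I \<and> (\<exists>y\<in>carrier M. x = y \<otimes>\<^bsub>M\<^esub> cl e)"
    using e by (auto simp: carrier_trace_monoid)
qed

section \<open>The inversion formula\<close>

text \<open>The letters of \<open>e\<close> fall independently of each other, so the height stays
  the same iff none of them comes to rest on the top layer \<open>c\<close>, that is, iff all are
  independent of all of \<open>c\<close>.\<close>

lemma height_mult_clique_iff:
  assumes "w \<in> lists \<Sigma>" "w \<noteq> []" "e \<in> cliques \<Sigma> I"
    and c: "c = layer (heap I w) (heap_height (heap I w))"
  shows "height \<Sigma> I (tr w \<otimes>\<^bsub>M\<^esub> cl e) = height \<Sigma> I (tr w) \<longleftrightarrow>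
    c \<inter> e = {} \<and> c \<union> e \<in> cliques \<Sigma> I"
proof -
  let ?P = "heap I w"
  let ?n = "heap_height ?P"
  have n: "?n > 0" using assms(2) heap_height_eq_0_iff[of I w] by simp
  note ew = clique_word_clique[OF assms(3)]
  have "heap I (w @ clique_word e) = ?P \<union> (\<lambda>a. (Suc (level I ?P a), a)) ` e"
    using foldl_drop_piece_clique[of "clique_word e" I ?P] ew assms(3)
    by (simp add: heap_def cliques_def)
  then have fst_heap: "fst ` heap I (w @ clique_word e) = fst ` ?P \<union> (\<lambda>a. Suc (level I ?P a)) ` e"
    by (simp add: image_Un image_image)
  have h: "height \<Sigma> I (tr w \<otimes>\<^bsub>M\<^esub> cl e) = heap_height (heap I (w @ clique_word e))"
    using assms ew by (simp add: clique_trace_word mult_trace_monoid height_tr)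
  have "heap_height (heap I (w @ clique_word e)) \<le> ?n \<longleftrightarrow> (\<forall>a\<in>e. Suc (level I ?P a) \<le> ?n)"
    unfolding heap_height_def[of "heap I (w @ clique_word e)"] fst_heap
    using fst_heap_le_height[OF finite_heap, of _ _ I w] finite_clique[OF assms(3)]
    by (subst Max_le_iff) auto
  moreover have "?n \<le> heap_height (heap I (w @ clique_word e))"
    by (rule heap_height_mono[OF finite_heap heap_append_subset])
  ultimately have "height \<Sigma> I (tr w \<otimes>\<^bsub>M\<^esub> cl e) = height \<Sigma> I (tr w) \<longleftrightarrow>
      (\<forall>a\<in>e. level I ?P a < ?n)"
    using h assms(1) by (auto simp: height_tr Suc_le_eq)
  also have "\<dots> \<longleftrightarrow> (\<forall>a\<in>e. \<forall>b\<in>c. (b, a) \<in> I)"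
  proof -
    have "level I ?P a < ?n \<longleftrightarrow> (\<forall>b\<in>c. (b, a) \<in> I)" for a
    proof
      assume "level I ?P a < ?n"
      then show "\<forall>b\<in>c. (b, a) \<in> I"
        using level_ge[OF finite_heap, of ?n _ I w a I] by (fastforce simp: c layer_def)
    next
      assume *: "\<forall>b\<in>c. (b, a) \<in> I"
      have "level I ?P a \<noteq> ?n"
      proof
        assume eq: "level I ?P a = ?n"
        then obtain b where "(?n, b) \<in> ?P" "(b, a) \<notin> I"
          using level_witness[OF finite_heap, of I I w a] n by auto
        then show False using * by (auto simp: c layer_def)
      qed
      then show "level I ?P a < ?n"
        using level_le_height[OF finite_heap, of I I w a] by simp
    qed
    then show ?thesis by simp
  qed
  also have "\<dots> \<longleftrightarrow> c \<inter> e = {} \<and> c \<union> e \<in> cliques \<Sigma> I"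
  proof -
    have clique: "c \<in> cliques \<Sigma> I" unfolding c by (rule layer_heap_in_cliques[OF assms(1)])
    show ?thesis
    proof
      assume *: "\<forall>a\<in>e. \<forall>b\<in>c. (b, a) \<in> I"
      then have "\<forall>a\<in>e. \<forall>b\<in>c. (a, b) \<in> I"
        using symD[OF sym_independence] by blast
      \<comment> \<open>A common letter would be independent of itself.\<close>
      moreover have "c \<inter> e = {}"
        using * irrefl_independence by (auto simp: irrefl_def)
      ultimately show "c \<inter> e = {} \<and> c \<union> e \<in> cliques \<Sigma> I"
        using * clique assms(3) by (auto simp: cliques_def)
    next
      assume *: "c \<inter> e = {} \<and> c \<union> e \<in> cliques \<Sigma> I"
      then have "b \<noteq> a" if "a \<in> e" "b \<in> c" for a b
        using that by auto
      with * show "\<forall>a\<in>e. \<forall>b\<in>c. (b, a) \<in> I"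
        by (simp add: cliques_def)
    qed
  qed
  finally show ?thesis .
qed

section \<open>The transform as an alternating sum over products with cliques\<close>

lemma graded_moebius_one:
  "graded_moebius \<Sigma> I F \<one>\<^bsub>M\<^esub> =
    (\<Sum>e\<in>cliques \<Sigma> I. (- 1) ^ card e * F (\<one>\<^bsub>M\<^esub> \<otimes>\<^bsub>M\<^esub> cl e))"
proof -
  have "graded_moebius \<Sigma> I F \<one>\<^bsub>M\<^esub> = (\<Sum>e\<in>cliques \<Sigma> I. (- 1) ^ card e * F (cl e))"
    by (simp only: graded_moebius_def if_True simp_thms)
  also have "\<dots> = (\<Sum>e\<in>cliques \<Sigma> I. (- 1) ^ card e * F (\<one>\<^bsub>M\<^esub> \<otimes>\<^bsub>M\<^esub> cl e))"
    by (intro sum.cong) (simp_all only: l_one[OF cl_in_carrier])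
  finally show ?thesis .
qed

text \<open>The substitution \<open>c' = c \<union> e\<close> turns \<open>v \<cdot> c'\<close> into
  \<open>x \<cdot> e\<close>. The resulting condition on \<open>e\<close> is preservation of the
  height, so the last clique disappears from the formula.\<close>

lemma graded_moebius_not_one:
  assumes "x \<in> carrier M" "x \<noteq> \<one>\<^bsub>M\<^esub>"
  shows "graded_moebius \<Sigma> I F x =
    (\<Sum>e | e \<in> cliques \<Sigma> I \<and> height \<Sigma> I (x \<otimes>\<^bsub>M\<^esub> cl e) = height \<Sigma> I x.
      (- 1) ^ card e * F (x \<otimes>\<^bsub>M\<^esub> cl e))"
proof -
  obtain w where w: "x = tr w" "w \<in> lists \<Sigma>" using assms(1) by (auto simp: carrier_trace_monoid)
  then have "w \<noteq> []" using assms(2) by (auto simp: one_trace_monoid)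
  let ?P = "heap I w"
  define c where "c = layer ?P (heap_height ?P)"
  define cs where "cs = butlast (layers ?P)"
  have "layers ?P \<noteq> []"
    using \<open>w \<noteq> []\<close> by (simp add: layers_def heap_height_eq_0_iff)
  moreover have "last (layers ?P) = c"
    using \<open>w \<noteq> []\<close> heap_height_eq_0_iff[of I w] by (simp add: layers_def c_def last_map)
  ultimately have lay: "layers ?P = cs @ [c]"
    by (metis cs_def append_butlast_last_id)
  have c: "c \<in> cliques \<Sigma> I" and cs: "set cs \<subseteq> cliques \<Sigma> I"
    using layers_in_cliques[OF w(2)] by (auto simp: lay)
  define v where "v = tr (cliques_word cs)"
  have v: "v \<in> carrier M"
    using cliques_word_in_lists[OF cs] by (auto simp: v_def carrier_trace_monoid)
  have x: "x = v \<otimes>\<^bsub>M\<^esub> cl c"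
    using tr_layers[OF w(2)] cliques_word_in_lists[OF cs] clique_word_clique[OF c]
    by (simp add: v_def w lay clique_trace_word mult_trace_monoid)
  \<comment> \<open>The product of all layers but the last is the only candidate, by right
    cancellation.\<close>
  have "(THE v. v \<in> carrier M \<and> x = v \<otimes>\<^bsub>M\<^esub> cl c) = v"
    using v x trace_right_cancel[OF cl_in_carrier[OF c]] by (intro the_equality) auto
  then have "graded_moebius \<Sigma> I F x = (\<Sum>c'\<in>{c'\<in>cliques \<Sigma> I. c \<subseteq> c'}.
      (- 1) ^ (card c' - card c) * F (v \<otimes>\<^bsub>M\<^esub> cl c'))"
    using assms(2) cartier_foata_tr[OF w(2) \<open>w \<noteq> []\<close>]
    by (simp add: graded_moebius_def w(1)[symmetric] lay)
  also have "\<dots> = (\<Sum>e | e \<in> cliques \<Sigma> I \<and> c \<inter> e = {} \<and> c \<union> e \<in> cliques \<Sigma> I.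
      (- 1) ^ card e * F (x \<otimes>\<^bsub>M\<^esub> cl e))"
  proof (rule sum.reindex_bij_witness[of _ "\<lambda>e. c \<union> e" "\<lambda>c'. c' - c"])
    fix c' assume c': "c' \<in> {c'\<in>cliques \<Sigma> I. c \<subseteq> c'}"
    then have un: "c \<union> (c' - c) = c'" by auto
    then show "c \<union> (c' - c) = c'" .
    have "c' - c \<in> cliques \<Sigma> I" using c' by (auto simp: cliques_def)
    then show "c' - c \<in> {e. e \<in> cliques \<Sigma> I \<and> c \<inter> e = {} \<and> c \<union> e \<in> cliques \<Sigma> I}"
      using c' un by auto
    have "cl c' = cl c \<otimes>\<^bsub>M\<^esub> cl (c' - c)"
      using cl_union[of c "c' - c"] c' un by auto
    then have "v \<otimes>\<^bsub>M\<^esub> cl c' = x \<otimes>\<^bsub>M\<^esub> cl (c' - c)"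
      using v c \<open>c' - c \<in> cliques \<Sigma> I\<close> by (simp add: x m_assoc cl_in_carrier)
    moreover have "card (c' - c) = card c' - card c"
      using c' finite_clique[OF c] by (simp add: card_Diff_subset)
    ultimately show "(- 1) ^ card (c' - c) * F (x \<otimes>\<^bsub>M\<^esub> cl (c' - c)) =
        (- 1) ^ (card c' - card c) * F (v \<otimes>\<^bsub>M\<^esub> cl c')" by simp
  qed auto
  also have "{e. e \<in> cliques \<Sigma> I \<and> c \<inter> e = {} \<and> c \<union> e \<in> cliques \<Sigma> I} =
      {e. e \<in> cliques \<Sigma> I \<and> height \<Sigma> I (x \<otimes>\<^bsub>M\<^esub> cl e) = height \<Sigma> I x}"
    using height_mult_clique_iff[OF w(2) \<open>w \<noteq> []\<close> _ c_def] by (auto simp: w(1))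
  finally show ?thesis .
qed

text \<open>Serves the empty and the nonempty \<open>u\<close> alike: \<open>S\<close> is a finite
  set of extensions of \<open>u\<close>, containing \<open>u\<close> and closed under prefixes that
  still extend \<open>u\<close>. Exchanging the sums leaves an alternating sum over a power set for
  each \<open>z\<close> in \<open>S\<close>.\<close>

lemma sum_alternating_interval:
  fixes F H :: "'a list set \<Rightarrow> real"
  assumes "u \<in> carrier M" "finite S" "u \<in> S"
    and S: "\<And>x. x \<in> S \<Longrightarrow> x \<in> carrier M \<and> u divides\<^bsub>M\<^esub> x"
    and between: "\<And>x y. x \<in> carrier M \<Longrightarrow> y \<in> carrier M \<Longrightarrow> u divides\<^bsub>M\<^esub> x \<Longrightarrow>
      x \<otimes>\<^bsub>M\<^esub> y \<in> S \<Longrightarrow> x \<in> S"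
    and H: "\<And>x. x \<in> S \<Longrightarrow> H x = (\<Sum>e | e \<in> cliques \<Sigma> I \<and> x \<otimes>\<^bsub>M\<^esub> cl e \<in> S.
      (- 1) ^ card e * F (x \<otimes>\<^bsub>M\<^esub> cl e))"
  shows "(\<Sum>x\<in>S. H x) = F u"
proof -
  let ?m = "\<lambda>(x, e). x \<otimes>\<^bsub>M\<^esub> cl e"
  \<comment> \<open>All index pairs of the double sum, to be regrouped by their product
    \<open>z\<close>.\<close>
  define D where "D = (SIGMA x:S. {e. e \<in> cliques \<Sigma> I \<and> x \<otimes>\<^bsub>M\<^esub> cl e \<in> S})"
  have fin: "finite {e. e \<in> cliques \<Sigma> I \<and> x \<otimes>\<^bsub>M\<^esub> cl e \<in> S}" for x
    using finite_cliques by simp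
  have finD: "finite D" unfolding D_def using assms(2) fin by blast
  have coeff: "(\<Sum>p\<in>{p\<in>D. ?m p = z}. (- 1) ^ card (snd p)) = (if z = u then 1 else 0 :: real)"
    if z: "z \<in> S" for z
  proof -
    obtain y where y: "y \<in> carrier M" "z = u \<otimes>\<^bsub>M\<^esub> y"
      using S[OF z] by (auto simp: factor_def)
    \<comment> \<open>Once \<open>z\<close> is fixed, \<open>e\<close> determines \<open>x\<close>
      by right cancellation, so the fibre may be indexed by \<open>e\<close> alone.\<close>
    have inj: "inj_on snd {p\<in>D. ?m p = z}"
    proof (rule inj_onI)
      fix p q assume p: "p \<in> {p\<in>D. ?m p = z}" and q: "q \<in> {p\<in>D. ?m p = z}" and "snd p = snd q"
      then obtain x x' e where pq: "p = (x, e)" "q = (x', e)"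
        by (metis prod.collapse)
      have "e \<in> cliques \<Sigma> I" "x \<in> S" "x' \<in> S" "x \<otimes>\<^bsub>M\<^esub> cl e = x' \<otimes>\<^bsub>M\<^esub> cl e"
        using p q by (simp_all add: pq D_def)
      then have "x = x'"
        using S trace_right_cancel[OF cl_in_carrier] by blast
      then show "p = q" by (simp add: pq)
    qed
    \<comment> \<open>Cancelling \<open>u\<close> on the left turns a factorization of
      \<open>z\<close> with last factor \<open>e\<close> into one of \<open>y\<close>, where
      \<open>clique_suffix_iff\<close> applies.\<close>
    have "snd ` {p\<in>D. ?m p = z} = Pow (last_letters y)"
    proof (intro Set.set_eqI iffI)
      fix e assume "e \<in> snd ` {p\<in>D. ?m p = z}"
      then obtain x where x: "x \<in> S" "e \<in> cliques \<Sigma> I" "x \<otimes>\<^bsub>M\<^esub> cl e = z"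
        by (auto simp: D_def)
      then obtain y' where y': "y' \<in> carrier M" "x = u \<otimes>\<^bsub>M\<^esub> y'"
        using S by (force simp: factor_def)
      then have "u \<otimes>\<^bsub>M\<^esub> (y' \<otimes>\<^bsub>M\<^esub> cl e) = u \<otimes>\<^bsub>M\<^esub> y"
        using x y assms(1) by (simp add: m_assoc cl_in_carrier)
      then have "y = y' \<otimes>\<^bsub>M\<^esub> cl e"
        using trace_left_cancel[OF assms(1), of "y' \<otimes>\<^bsub>M\<^esub> cl e" y] y y' x cl_in_carrier by simp
      then show "e \<in> Pow (last_letters y)"
        using clique_suffix_iff[OF y(1), of e] x y' by auto
    next
      fix e assume "e \<in> Pow (last_letters y)"
      then obtain y' where e: "e \<in> cliques \<Sigma> I" and y': "y' \<in> carrier M" "y = y' \<otimes>\<^bsub>M\<^esub> cl e"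
        using clique_suffix_iff[OF y(1), of e] by auto
      have eq: "(u \<otimes>\<^bsub>M\<^esub> y') \<otimes>\<^bsub>M\<^esub> cl e = z"
        using e y' y assms(1) by (simp add: m_assoc cl_in_carrier)
      \<comment> \<open>The prefix of \<open>z\<close> left after removing \<open>e\<close> still
        extends \<open>u\<close>, so the closure property of \<open>S\<close> applies.\<close>
      then have "u \<otimes>\<^bsub>M\<^esub> y' \<in> S"
        using between[of "u \<otimes>\<^bsub>M\<^esub> y'" "cl e"] z y' assms(1) cl_in_carrier[OF e]
        by (auto simp: factor_def)
      then have "(u \<otimes>\<^bsub>M\<^esub> y', e) \<in> {p\<in>D. ?m p = z}"
        using eq e z by (simp add: D_def)
      then show "e \<in> snd ` {p\<in>D. ?m p = z}" by force
    qed
    then have "(\<Sum>p\<in>{p\<in>D. ?m p = z}. (- 1 :: real) ^ card (snd p)) =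
        (\<Sum>e\<in>Pow (last_letters y). (- 1) ^ card e)"
      using sum.reindex[OF inj, of "\<lambda>e. (- 1 :: real) ^ card e"] by simp
    moreover have "finite (last_letters y)"
      by (rule finite_subset[OF _ finite_alphabet]) (auto simp: last_letters_def)
    moreover have "y = \<one>\<^bsub>M\<^esub> \<longleftrightarrow> z = u"
      using trace_left_cancel[OF assms(1) y(1) one_closed] y assms(1) by auto
    ultimately show ?thesis
      using last_letters_empty_iff[OF y(1)] by (simp add: sum_Pow_alternating)
  qed
  have "(\<Sum>x\<in>S. H x) = (\<Sum>p\<in>D. (- 1) ^ card (snd p) * F (?m p))"
    unfolding D_def using H fin by (simp add: sum.Sigma[OF assms(2)] split_beta)
  also have "\<dots> = (\<Sum>z\<in>S. \<Sum>p\<in>{p\<in>D. ?m p = z}. (- 1) ^ card (snd p) * F (?m p))"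
    by (rule sum.group[OF finD assms(2), symmetric]) (auto simp: D_def)
  also have "\<dots> = (\<Sum>z\<in>S. (\<Sum>p\<in>{p\<in>D. ?m p = z}. (- 1) ^ card (snd p)) * F z)"
    by (simp add: sum_distrib_right)
  also have "\<dots> = (\<Sum>z\<in>S. if z = u then F z else 0)"
    by (intro sum.cong) (simp_all add: coeff)
  also have "\<dots> = F u"
    using assms(2,3) by simp
  finally show ?thesis .
qed

section \<open>The formula for the empty and for nonempty traces\<close>

lemma sum_graded_moebius_one:
  "(\<Sum>x\<in>cl ` cliques \<Sigma> I. graded_moebius \<Sigma> I F x) = F \<one>\<^bsub>M\<^esub>"
  unfolding clique_traces_eq_height_le_1
proof (rule sum_alternating_interval)
  let ?S = "{x \<in> carrier M. height \<Sigma> I x \<le> 1}"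
  show "finite ?S" by (rule finite_height_le)
  show "\<one>\<^bsub>M\<^esub> \<in> ?S" by (simp add: height_def)
  show "x \<in> carrier M \<and> \<one>\<^bsub>M\<^esub> divides\<^bsub>M\<^esub> x" if "x \<in> ?S" for x
    using that by (auto simp: factor_def)
  show "x \<in> ?S" if "x \<in> carrier M" "y \<in> carrier M" "x \<otimes>\<^bsub>M\<^esub> y \<in> ?S" for x y
    using that height_le_mult[OF that(1,2)] by simp
  fix x assume x: "x \<in> ?S"
  show "graded_moebius \<Sigma> I F x = (\<Sum>e | e \<in> cliques \<Sigma> I \<and> x \<otimes>\<^bsub>M\<^esub> cl e \<in> ?S.
      (- 1) ^ card e * F (x \<otimes>\<^bsub>M\<^esub> cl e))"
  proof (cases "x = \<one>\<^bsub>M\<^esub>")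
    \<comment> \<open>Every clique has height at most 1, so the condition on \<open>e\<close> is
      vacuous and the sum runs over all cliques.\<close>
    case True
    have "\<one>\<^bsub>M\<^esub> \<otimes>\<^bsub>M\<^esub> cl e \<in> ?S" if "e \<in> cliques \<Sigma> I" for e
      using that clique_traces_eq_height_le_1 cl_in_carrier[OF that] by auto
    then have "{e. e \<in> cliques \<Sigma> I \<and> \<one>\<^bsub>M\<^esub> \<otimes>\<^bsub>M\<^esub> cl e \<in> ?S} = cliques \<Sigma> I" by blast
    then show ?thesis using True by (simp only: graded_moebius_one)
  next
    case False
    obtain w where w: "x = tr w" "w \<in> lists \<Sigma>" using x by (auto simp: carrier_trace_monoid)
    then have "height \<Sigma> I x \<noteq> 0"
      using False by (auto simp: height_tr heap_height_eq_0_iff one_trace_monoid)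
    \<comment> \<open>At height exactly 1, a product of height at most 1 has the same height as
      \<open>x\<close>, by monotonicity.\<close>
    then have "height \<Sigma> I x = 1" using x by simp
    then have "x \<otimes>\<^bsub>M\<^esub> cl e \<in> ?S \<longleftrightarrow> height \<Sigma> I (x \<otimes>\<^bsub>M\<^esub> cl e) = height \<Sigma> I x"
      if "e \<in> cliques \<Sigma> I" for e
      using x height_le_mult[of x "cl e"] cl_in_carrier[OF that] by auto
    then show ?thesis
      using x False by (subst graded_moebius_not_one) (auto intro!: sum.cong)
  qed
qed simp

lemma sum_graded_moebius_not_one:
  assumes "u \<in> carrier M" "u \<noteq> \<one>\<^bsub>M\<^esub>"
  shows "(\<Sum>x\<in>same_height_above \<Sigma> I u. graded_moebius \<Sigma> I F x) = F u"
proof (rule sum_alternating_interval)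
  let ?S = "same_height_above \<Sigma> I u"
  have S: "?S = {x \<in> carrier M. height \<Sigma> I x = height \<Sigma> I u \<and> u divides\<^bsub>M\<^esub> x}"
    using assms(2) by (simp add: same_height_above_def)
  show "u \<in> carrier M" by fact
  show "finite ?S"
    by (rule finite_subset[OF _ finite_height_le[of "height \<Sigma> I u"]]) (auto simp: S)
  show "u \<in> ?S" using assms(1) by (simp add: S)
  show "x \<in> carrier M \<and> u divides\<^bsub>M\<^esub> x" if "x \<in> ?S" for x
    using that by (simp add: S)
  show "x \<in> ?S" if "x \<in> carrier M" "y \<in> carrier M" "u divides\<^bsub>M\<^esub> x" "x \<otimes>\<^bsub>M\<^esub> y \<in> ?S" for x y
  proof -
    \<comment> \<open>The height of \<open>x\<close> is squeezed between those of \<open>u\<close>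
      and of the product, which agree.\<close>
    have "height \<Sigma> I u \<le> height \<Sigma> I x"
      using that(3) height_le_mult[OF assms(1)] by (auto simp: factor_def)
    then show ?thesis using that height_le_mult[OF that(1,2)] by (simp add: S)
  qed
  fix x assume x: "x \<in> ?S"
  \<comment> \<open>The height of \<open>u\<close> is positive, which keeps the special value at the
    empty trace out of the sum.\<close>
  have "x \<noteq> \<one>\<^bsub>M\<^esub>"
  proof
    assume "x = \<one>\<^bsub>M\<^esub>"
    then have "height \<Sigma> I u = 0" using x by (simp add: S height_def)
    moreover obtain w where "u = tr w" "w \<in> lists \<Sigma>"
      using assms(1) by (auto simp: carrier_trace_monoid)
    ultimately show False
      using assms(2) by (simp add: height_tr heap_height_eq_0_iff one_trace_monoid)
  qed
  moreover have "x \<otimes>\<^bsub>M\<^esub> cl e \<in> ?S \<longleftrightarrow> height \<Sigma> I (x \<otimes>\<^bsub>M\<^esub> cl e) = height \<Sigma> I x"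
    if "e \<in> cliques \<Sigma> I" for e
    using x cl_in_carrier[OF that] assms(1) by (auto simp: S intro: divides_prod_r)
  ultimately show "graded_moebius \<Sigma> I F x = (\<Sum>e | e \<in> cliques \<Sigma> I \<and> x \<otimes>\<^bsub>M\<^esub> cl e \<in> ?S.
      (- 1) ^ card e * F (x \<otimes>\<^bsub>M\<^esub> cl e))"
    using x by (subst graded_moebius_not_one) (auto simp: S intro!: sum.cong)
qed

end

theorem theorem1:
  fixes \<Sigma> :: "'a set" and I :: "'a rel" and F :: "'a list set \<Rightarrow> real" and u :: "'a list set"
  assumes "finite \<Sigma>" and "card \<Sigma> > 1"
    and "I \<subseteq> \<Sigma> \<times> \<Sigma>" and "sym I" and "irrefl I"
    and "u \<in> carrier (trace_monoid \<Sigma> I)"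
  shows "F u = (\<Sum>x\<in>same_height_above \<Sigma> I u. graded_moebius \<Sigma> I F x)"
proof -
  interpret independence_alphabet \<Sigma> I
    using assms by unfold_locales
  show ?thesis
    using sum_graded_moebius_one[of F] sum_graded_moebius_not_one[OF assms(6), of F]
    by (cases "u = \<one>\<^bsub>M\<^esub>") (simp_all add: same_height_above_def)
qed

end
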